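(* Let $\mathbb{V}$ be a vector space of dimension $n\ge 3$ over the field of $2$ elements, with basis $\{b_1,\dots,b_n\}$, and let $G(\mathbb{V})$ be its non-zero component graph. Let $u,v\in T_i$ for some $i$ with $1\le i\le n-1$. Then $$fix(u,v)=\{w\in S(G(\mathbb{V})): |S_w\cap S_u|\neq |S_w\cap S_v|\}.$$
   Context: The non-zero component graph $G(\mathbb{V})$ (with respect to the basis $\{b_1,\dots,b_n\}$) has as vertices the non-zero vectors of $\mathbb{V}$; two distinct vertices are adjacent iff some $b_j$ has non-zero coefficient in both of their expansions in the basis. The skeleton $S_u$ of a vertex $u$ is the set of basis vectors having non-zero coefficient in the expansion of $u$. $T_i=\{v\in V(G(\mathbb{V})): |S_v|=i\}$ for $1\le i\le n$. For a graph $G$, $\Gamma(G)$ is its automorphism group, $\Gamma_x(G)$ is the stabilizer of the vertex $x$, $\mathcal{O}(u)$ is the orbit of $u$ under $\Gamma(G)$, and $\mathcal{O}_x(u)=\{g(u): g\in\Gamma_x(G)\}$. $S(G)=\{v\in V(G): |\mathcal{O}(v)|\ge 2\}$. For $(u,v)\in S(G)\times S(G)$, the fixing neighborhood is $fix(u,v)=\{x\in S(G): \mathcal{O}_x(u)\ne\mathcal{O}_x(v)\}$ (with the convention $fix(u,v)=\emptyset$ for distinct $u,v$ with $\mathcal{O}(u)\neq\mathcal{O}(v)$). *)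

theory Defs
  imports Complex_Main "HOL-Combinatorics.Permutations"
begin

text \<open>Simple graphs are given by a vertex set and an adjacency relation, which is read
  only on vertices.\<close>

record 'a graph =
  verts :: "'a set"
  adj :: "'a \<Rightarrow> 'a \<Rightarrow> bool"

text \<open>Automorphisms are total functions; \<open>permutes\<close> makes them the identity outside
  the vertex set, so that distinct functions are distinct automorphisms.\<close>

definition automorphisms :: "('a, 'm) graph_scheme \<Rightarrow> ('a \<Rightarrow> 'a) set" where
  "automorphisms G =
    {g. g permutes verts G \<and> (\<forall>x\<in>verts G. \<forall>y\<in>verts G. adj G (g x) (g y) \<longleftrightarrow> adj G x y)}"

definition vertex_stabilizer :: "('a, 'm) graph_scheme \<Rightarrow> 'a \<Rightarrow> ('a \<Rightarrow> 'a) set" where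
  "vertex_stabilizer G x = {g \<in> automorphisms G. g x = x}"

definition vertex_orbit :: "('a, 'm) graph_scheme \<Rightarrow> 'a \<Rightarrow> 'a set" where
  "vertex_orbit G u = {g u | g. g \<in> automorphisms G}"

definition stabilizer_orbit :: "('a, 'm) graph_scheme \<Rightarrow> 'a \<Rightarrow> 'a \<Rightarrow> 'a set" where
  "stabilizer_orbit G x u = {g u | g. g \<in> vertex_stabilizer G x}"

text \<open>For finite graphs only: the cardinality of an infinite orbit would be \<open>0\<close>.\<close>

definition moved_vertices :: "('a, 'm) graph_scheme \<Rightarrow> 'a set" where
  "moved_vertices G = {v \<in> verts G. card (vertex_orbit G v) \<ge> 2}"

text \<open>The first case is a convention: pairs in different orbits have an empty
  fixing neighborhood. It never applies to \<open>u = v\<close>. The notion is meant for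
  \<open>u\<close> and \<open>v\<close> in \<^term>\<open>moved_vertices G\<close>.\<close>

definition fixing_nbhd :: "('a, 'm) graph_scheme \<Rightarrow> 'a \<Rightarrow> 'a \<Rightarrow> 'a set" where
  "fixing_nbhd G u v =
    (if vertex_orbit G u \<noteq> vertex_orbit G v then {}
     else {x \<in> moved_vertices G. stabilizer_orbit G x u \<noteq> stabilizer_orbit G x v})"

definition skeleton :: "('k::field \<Rightarrow> 'v::ab_group_add \<Rightarrow> 'v) \<Rightarrow> 'v set \<Rightarrow> 'v \<Rightarrow> 'v set" where
  "skeleton scale B u = {b \<in> B. module.representation scale B u b \<noteq> 0}"

definition nonzero_component_graph ::
    "('k::field \<Rightarrow> 'v::ab_group_add \<Rightarrow> 'v) \<Rightarrow> 'v set \<Rightarrow> 'v graph" where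
  "nonzero_component_graph scale B =
    \<lparr>verts = UNIV - {0},
     adj = (\<lambda>u v. u \<noteq> 0 \<and> v \<noteq> 0 \<and> u \<noteq> v \<and>
       (\<exists>b\<in>B. module.representation scale B u b \<noteq> 0 \<and> module.representation scale B v b \<noteq> 0))\<rparr>"

definition skeleton_class ::
    "('k::field \<Rightarrow> 'v::ab_group_add \<Rightarrow> 'v) \<Rightarrow> 'v set \<Rightarrow> nat \<Rightarrow> 'v set" where
  "skeleton_class scale B i =
    {v \<in> verts (nonzero_component_graph scale B). card (skeleton scale B v) = i}"

end

theory Submission
  imports Defs
begin

text \<open>Over the field of two elements a vector is determined by its skeleton, so the graph is the
  intersection graph of the nonempty subsets of the basis. A permutation of the basis lifts to
  an automorphism; if \<open>S\<^sub>w\<close> meets \<open>S\<^sub>u\<close> and \<open>S\<^sub>v\<close> in equally many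
  elements, some permutation stabilizes \<open>S\<^sub>w\<close> and carries \<open>S\<^sub>u\<close> to
  \<open>S\<^sub>v\<close>. Conversely, the number of common non-neighbours of \<open>u\<close> and \<open>w\<close> is
  \<open>2 ^ (n - |S\<^sub>u \<union> S\<^sub>w|) - 1\<close>, so an automorphism that fixes \<open>w\<close> and sends
  \<open>u\<close> to \<open>v\<close> preserves \<open>|S\<^sub>u \<union> S\<^sub>w|\<close>, hence \<open>|S\<^sub>u \<inter> S\<^sub>w|\<close>. No
  classification of the automorphisms is needed.\<close>

section \<open>Permutations of a finite set with prescribed images\<close>

text \<open>Since \<open>A\<close> is finite, the complements of \<open>X\<close> and
  \<open>Y\<close> also have equal size, so a bijection from \<open>X\<close> to \<open>Y\<close>
  can be glued to one between the complements.\<close>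

lemma permutes_image_eq:
  assumes "finite A" "X \<subseteq> A" "Y \<subseteq> A" "card X = card Y"
  obtains p where "p permutes A" "p ` X = Y"
proof -
  have fin: "finite X" "finite Y"
    using assms finite_subset by auto
  obtain f where f: "bij_betw f X Y"
    using finite_same_card_bij[OF fin assms(4)] by blast
  have "card (A - X) = card (A - Y)"
    using assms fin by (simp add: card_Diff_subset)
  then obtain g where g: "bij_betw g (A - X) (A - Y)"
    using finite_same_card_bij assms(1) by (metis finite_Diff)
  define h where "h x = (if x \<in> X then f x else g x)" for x
  define p where "p x = (if x \<in> A then h x else x)" for x
  have "bij_betw h (X \<union> (A - X)) (Y \<union> (A - Y))"
    unfolding h_def using f g by (intro bij_betw_disjoint_Un) auto
  then have "bij_betw h A A"
    using assms by (simp add: Un_absorb1)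
  then have "bij_betw p A A"
    by (subst bij_betw_cong[of _ _ h]) (auto simp: p_def)
  then have "p permutes A"
    by (rule bij_imp_permutes) (simp add: p_def)
  moreover have "p ` X = f ` X"
    using assms by (intro image_cong) (auto simp: p_def h_def)
  ultimately show ?thesis
    using that f by (simp add: bij_betw_def)
qed

text \<open>\<open>U\<close> and \<open>V\<close> have equally many elements inside
  \<open>W\<close>, hence also outside it. The two portions are matched separately, by a permutation
  of \<open>W\<close> and one of \<open>A - W\<close>, and the two permutations are
  composed.\<close>

lemma permutes_image_eq_stabilizing:
  assumes "finite A" "U \<subseteq> A" "V \<subseteq> A" "W \<subseteq> A"
    and "card U = card V" "card (W \<inter> U) = card (W \<inter> V)"
  obtains p where "p permutes A" "p ` U = V" "p ` W = W"
proof -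
  have fin: "finite U" "finite V" "finite W"
    using assms(1-4) by (auto intro: finite_subset)
  have "card (U - W) = card (V - W)"
    using assms fin by (simp add: card_Diff_subset_Int Int_commute)
  then obtain q where q: "q permutes A - W" "q ` (U - W) = V - W"
    using assms permutes_image_eq[of "A - W" "U - W" "V - W"] by blast
  obtain p where p: "p permutes W" "p ` (W \<inter> U) = W \<inter> V"
    using permutes_image_eq[of W "W \<inter> U" "W \<inter> V"] assms fin by blast
  \<comment> \<open>The two factors do not interfere: \<open>q\<close> is the identity on
    \<open>W\<close>, and \<open>p\<close> is the identity off \<open>W\<close>.\<close>
  have qW: "q ` X = X" if "X \<subseteq> W" for X
    using that permutes_not_in[OF q(1)] by (force simp: image_iff)
  have pW: "p ` X = X" if "X \<inter> W = {}" for X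
    using that permutes_not_in[OF p(1)] by (force simp: image_iff)
  have "p \<circ> q permutes A"
    using p(1) q(1) assms(4) by (intro permutes_compose) (auto intro: permutes_subset)
  moreover have "(p \<circ> q) ` W = W"
    using qW[of W] permutes_image[OF p(1)] by (simp only: image_comp[symmetric] subset_refl)
  moreover have "(p \<circ> q) ` U = V"
  proof -
    have "(p \<circ> q) ` U = p ` q ` (W \<inter> U) \<union> p ` q ` (U - W)"
      by (auto simp: image_iff)
    also have "\<dots> = (W \<inter> V) \<union> (V - W)"
      using qW[of "W \<inter> U"] pW[of "V - W"] p(2) q(2) by auto
    finally show ?thesis by auto
  qed
  ultimately show ?thesis using that by blast
qed

section \<open>Automorphisms, stabilizers and orbits\<close>

lemma automorphisms_comp:
  assumes "g \<in> automorphisms G" "h \<in> automorphisms G"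
  shows "g \<circ> h \<in> automorphisms G"
  using assms by (auto simp: automorphisms_def permutes_compose permutes_in_image)

lemma automorphisms_inv:
  assumes "g \<in> automorphisms G"
  shows "inv g \<in> automorphisms G"
proof -
  have g: "g permutes verts G"
    using assms by (simp add: automorphisms_def)
  have "adj G (inv g x) (inv g y) \<longleftrightarrow> adj G x y" if "x \<in> verts G" "y \<in> verts G" for x y
  proof -
    have "inv g x \<in> verts G" "inv g y \<in> verts G"
      using that permutes_in_image[OF permutes_inv[OF g]] by auto
    then show ?thesis
      using assms permutes_inverses(1)[OF g] by (force simp: automorphisms_def)
  qed
  then show ?thesis
    using permutes_inv[OF g] by (simp add: automorphisms_def)
qed

lemma vertex_stabilizer_comp:
  "g \<in> vertex_stabilizer G x \<Longrightarrow> h \<in> vertex_stabilizer G x \<Longrightarrow> g \<circ> h \<in> vertex_stabilizer G x"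
  by (simp add: vertex_stabilizer_def automorphisms_comp)

lemma vertex_stabilizer_inv:
  assumes "g \<in> vertex_stabilizer G x"
  shows "inv g \<in> vertex_stabilizer G x"
proof -
  have "g permutes verts G" "g x = x"
    using assms by (auto simp: vertex_stabilizer_def automorphisms_def)
  then have "inv g x = x"
    by (metis permutes_inverses(2))
  then show ?thesis
    using assms by (simp add: vertex_stabilizer_def automorphisms_inv)
qed

lemma id_in_vertex_stabilizer: "id \<in> vertex_stabilizer G x"
  by (simp add: vertex_stabilizer_def automorphisms_def permutes_id)

text \<open>One inclusion suffices, because the reverse one is the same inclusion for
  \<open>inv g\<close> at the point \<open>g u\<close>.\<close>

lemma vertex_orbit_image:
  assumes "g \<in> automorphisms G"
  shows "vertex_orbit G (g u) = vertex_orbit G u"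
proof
  have sub: "vertex_orbit G (h y) \<subseteq> vertex_orbit G y" if "h \<in> automorphisms G" for h y
  proof
    fix z assume "z \<in> vertex_orbit G (h y)"
    then obtain k where "k \<in> automorphisms G" "z = (k \<circ> h) y"
      by (auto simp: vertex_orbit_def)
    then show "z \<in> vertex_orbit G y"
      unfolding vertex_orbit_def using automorphisms_comp[OF _ that] by blast
  qed
  show "vertex_orbit G (g u) \<subseteq> vertex_orbit G u"
    by (rule sub[OF assms])
  have "g permutes verts G"
    using assms by (simp add: automorphisms_def)
  then show "vertex_orbit G u \<subseteq> vertex_orbit G (g u)"
    using sub[OF automorphisms_inv[OF assms], of "g u"] by (simp add: permutes_inverses(2))
qed

lemma stabilizer_orbit_image:
  assumes "g \<in> vertex_stabilizer G x"
  shows "stabilizer_orbit G x (g u) = stabilizer_orbit G x u"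
proof
  have sub: "stabilizer_orbit G x (h y) \<subseteq> stabilizer_orbit G x y" if "h \<in> vertex_stabilizer G x" for h y
  proof
    fix z assume "z \<in> stabilizer_orbit G x (h y)"
    then obtain k where "k \<in> vertex_stabilizer G x" "z = (k \<circ> h) y"
      by (auto simp: stabilizer_orbit_def)
    then show "z \<in> stabilizer_orbit G x y"
      unfolding stabilizer_orbit_def using vertex_stabilizer_comp[OF _ that] by blast
  qed
  show "stabilizer_orbit G x (g u) \<subseteq> stabilizer_orbit G x u"
    by (rule sub[OF assms])
  have "g permutes verts G"
    using assms by (simp add: vertex_stabilizer_def automorphisms_def)
  then show "stabilizer_orbit G x u \<subseteq> stabilizer_orbit G x (g u)"
    using sub[OF vertex_stabilizer_inv[OF assms], of "g u"] by (simp add: permutes_inverses(2))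
qed

section \<open>The intersection graph of the nonempty subsets of a finite set\<close>

text \<open>Isolates what the argument uses of the vector space; the skeleton map is the intended
  \<open>S\<close>.\<close>

locale subset_intersection_graph =
  fixes G :: "('a, 'm) graph_scheme" and B :: "'b set" and S :: "'a \<Rightarrow> 'b set"
  assumes finite_ground: "finite B"
    and bij_S: "bij_betw S (verts G) (Pow B - {{}})"
    and adj_iff: "x \<in> verts G \<Longrightarrow> y \<in> verts G \<Longrightarrow> adj G x y \<longleftrightarrow> x \<noteq> y \<and> S x \<inter> S y \<noteq> {}"
begin

lemma S_subset: "x \<in> verts G \<Longrightarrow> S x \<subseteq> B"
  using bij_S by (auto simp: bij_betw_def)

lemma S_inject: "x \<in> verts G \<Longrightarrow> y \<in> verts G \<Longrightarrow> S x = S y \<longleftrightarrow> x = y"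
  using bij_S by (auto simp: bij_betw_def inj_on_def)

text \<open>Conjugating the image map of \<open>p\<close> by the bijection \<open>S\<close> gives a
  permutation of the vertices. It respects adjacency because \<open>p\<close> is injective, so
  images meet exactly when the sets do.\<close>

lemma permutation_lifts:
  assumes p: "p permutes B"
  obtains g where "g \<in> automorphisms G" "\<And>x. x \<in> verts G \<Longrightarrow> S (g x) = p ` S x"
proof -
  define h where "h = inv_into (verts G) S \<circ> ((`) p \<circ> S)"
  define g where "g x = (if x \<in> verts G then h x else x)" for x
  have "bij_betw ((`) p) (Pow B) (Pow B)"
    by (rule bij_betw_Pow[OF permutes_imp_bij[OF p]])
  then have "bij_betw ((`) p) (Pow B - {{}}) (Pow B - {{}})"
    by (rule bij_betw_DiffI) (auto simp: bij_betw_def)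
  then have h: "bij_betw h (verts G) (verts G)"
    unfolding h_def using bij_S by (meson bij_betw_trans bij_betw_inv_into)
  then have "bij_betw g (verts G) (verts G)"
    by (subst bij_betw_cong[of _ _ h]) (auto simp: g_def)
  then have perm: "g permutes verts G"
    by (rule bij_imp_permutes) (simp add: g_def)
  have S_g: "S (g x) = p ` S x" if "x \<in> verts G" for x
  proof -
    have "S x \<in> Pow B - {{}}"
      using that bij_S by (auto simp: bij_betw_def)
    then have "p ` S x \<in> S ` verts G"
      using permutes_image[OF p] bij_S by (auto simp: bij_betw_def)
    then show ?thesis
      using that by (simp add: g_def h_def f_inv_into_f)
  qed
  have "adj G (g x) (g y) \<longleftrightarrow> adj G x y" if "x \<in> verts G" "y \<in> verts G" for x y
  proof -
    have "g x = g y \<longleftrightarrow> x = y"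
      using permutes_inj[OF perm] by (auto simp: inj_def)
    moreover have "p ` S x \<inter> p ` S y = {} \<longleftrightarrow> S x \<inter> S y = {}"
      using permutes_inj[OF p] by (simp add: image_Int[symmetric])
    ultimately show ?thesis
      using that adj_iff permutes_in_image[OF perm] by (simp add: S_g)
  qed
  then have "g \<in> automorphisms G"
    using perm by (simp add: automorphisms_def)
  then show ?thesis using that S_g by blast
qed

text \<open>\<open>W\<close> is a set rather than a vertex so that \<open>W = {}\<close> is allowed:
  the fixing clause is then vacuous and what remains is that vertices with equally large sets share
  an orbit.\<close>

lemma automorphism_of_cards:
  assumes "u \<in> verts G" "v \<in> verts G" "card (S u) = card (S v)"
    and "W \<subseteq> B" "card (W \<inter> S u) = card (W \<inter> S v)"
  obtains g where "g \<in> automorphisms G" "g u = v"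
    "\<And>w. w \<in> verts G \<Longrightarrow> S w = W \<Longrightarrow> g w = w"
proof -
  obtain p where p: "p permutes B" "p ` S u = S v" "p ` W = W"
    using permutes_image_eq_stabilizing[of B "S u" "S v" W] assms finite_ground S_subset by blast
  obtain g where g: "g \<in> automorphisms G" "\<And>x. x \<in> verts G \<Longrightarrow> S (g x) = p ` S x"
    using permutation_lifts[OF p(1)] by blast
  have "g x \<in> verts G" if "x \<in> verts G" for x
    using g(1) that by (auto simp: automorphisms_def permutes_in_image)
  then show ?thesis
    using that g p(2,3) assms(1,2) S_inject by metis
qed

text \<open>No vertex is adjacent to itself, so \<open>u\<close> and \<open>w\<close> have to be
  excluded by hand; then membership means exactly that \<open>S x\<close> is disjoint from
  \<open>S u \<union> S w\<close>.\<close>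

definition common_nonneighbours :: "'a \<Rightarrow> 'a \<Rightarrow> 'a set" where
  "common_nonneighbours u w =
    {x \<in> verts G. x \<noteq> u \<and> x \<noteq> w \<and> \<not> adj G x u \<and> \<not> adj G x w}"

text \<open>\<open>S\<close> maps these vertices onto the nonempty subsets of
  \<open>B - (S u \<union> S w)\<close>; the \<open>- 1\<close> accounts for the empty set, which
  belongs to no vertex.\<close>

lemma card_common_nonneighbours:
  assumes "u \<in> verts G" "w \<in> verts G"
  shows "card (common_nonneighbours u w) = 2 ^ (card B - card (S u \<union> S w)) - 1"
proof -
  have S: "S u \<union> S w \<subseteq> B" "S u \<noteq> {}" "S w \<noteq> {}"
    using assms bij_S by (auto simp: bij_betw_def)
  have iff: "x \<in> common_nonneighbours u w \<longleftrightarrow> x \<in> verts G \<and> S x \<inter> (S u \<union> S w) = {}" for x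
    using assms S adj_iff by (auto simp: common_nonneighbours_def)
  have "bij_betw S (common_nonneighbours u w) (S ` common_nonneighbours u w)"
    using bij_S iff by (auto simp: bij_betw_def intro: inj_on_subset)
  moreover have "S ` common_nonneighbours u w = Pow (B - (S u \<union> S w)) - {{}}"
  proof
    show "S ` common_nonneighbours u w \<subseteq> Pow (B - (S u \<union> S w)) - {{}}"
    proof
      fix X assume "X \<in> S ` common_nonneighbours u w"
      then obtain x where x: "X = S x" "x \<in> verts G" "S x \<inter> (S u \<union> S w) = {}"
        using iff by auto
      then have "S x \<in> Pow B - {{}}"
        using bij_S by (auto simp: bij_betw_def)
      then show "X \<in> Pow (B - (S u \<union> S w)) - {{}}"
        using x by blast
    qed
    show "Pow (B - (S u \<union> S w)) - {{}} \<subseteq> S ` common_nonneighbours u w"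
    proof
      fix X assume X: "X \<in> Pow (B - (S u \<union> S w)) - {{}}"
      then have "X \<in> S ` verts G"
        using bij_S by (auto simp: bij_betw_def)
      then show "X \<in> S ` common_nonneighbours u w"
        using X iff by blast
    qed
  qed
  ultimately have "card (common_nonneighbours u w) = card (Pow (B - (S u \<union> S w)) - {{}})"
    by (metis bij_betw_same_card)
  also have "\<dots> = 2 ^ card (B - (S u \<union> S w)) - 1"
    using finite_ground by (simp add: card_Pow)
  finally show ?thesis
    using S(1) finite_ground by (metis card_Diff_subset finite_subset)
qed

lemma common_nonneighbours_automorphism:
  assumes "g \<in> automorphisms G" "u \<in> verts G" "w \<in> verts G"
  shows "common_nonneighbours (g u) (g w) = g ` common_nonneighbours u w"
proof -
  have g: "g permutes verts G"
    and adj: "\<And>x y. x \<in> verts G \<Longrightarrow> y \<in> verts G \<Longrightarrow> adj G (g x) (g y) \<longleftrightarrow> adj G x y"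
    using assms(1) by (auto simp: automorphisms_def)
  have iff: "g x \<in> common_nonneighbours (g u) (g w) \<longleftrightarrow> x \<in> common_nonneighbours u w" for x
    using assms(2,3) adj permutes_in_image[OF g] permutes_inj[OF g]
    by (auto simp: common_nonneighbours_def inj_eq)
  show ?thesis
  proof
    show "common_nonneighbours (g u) (g w) \<subseteq> g ` common_nonneighbours u w"
    proof
      fix y assume "y \<in> common_nonneighbours (g u) (g w)"
      moreover obtain x where "y = g x"
        using permutes_surj[OF g] by (rule surjE)
      ultimately show "y \<in> g ` common_nonneighbours u w"
        using iff by simp
    qed
  qed (use iff in auto)
qed

text \<open>The number of common non-neighbours is a graph invariant, and it determines the size of
  the union.\<close>

lemma card_S_Un_automorphism:
  assumes "g \<in> automorphisms G" "u \<in> verts G" "w \<in> verts G"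
  shows "card (S (g u) \<union> S (g w)) = card (S u \<union> S w)"
proof -
  have g: "g permutes verts G"
    using assms(1) by (simp add: automorphisms_def)
  have "card (common_nonneighbours (g u) (g w)) = card (common_nonneighbours u w)"
    unfolding common_nonneighbours_automorphism[OF assms]
    by (intro card_image inj_on_subset[OF permutes_inj[OF g]]) simp
  moreover have gV: "g u \<in> verts G" "g w \<in> verts G"
    using assms g by (auto simp: permutes_in_image)
  \<comment> \<open>Allows the truncated \<open>- 1\<close> to be cancelled on both sides.\<close>
  moreover have "(1::nat) \<le> 2 ^ k" for k
    by simp
  ultimately have "(2::nat) ^ (card B - card (S (g u) \<union> S (g w))) = 2 ^ (card B - card (S u \<union> S w))"
    using assms by (metis card_common_nonneighbours le_add_diff_inverse)
  then have "card B - card (S (g u) \<union> S (g w)) = card B - card (S u \<union> S w)"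
    by simp
  \<comment> \<open>With this bound the truncated difference from \<open>card B\<close> is
    injective.\<close>
  moreover have "card (S x \<union> S y) \<le> card B" if "x \<in> verts G" "y \<in> verts G" for x y
    using that S_subset finite_ground by (intro card_mono) auto
  ultimately show ?thesis
    using assms gV by (metis diff_diff_cancel)
qed

lemma fixing_nbhd_eq:
  assumes uv: "u \<in> verts G" "v \<in> verts G" and card: "card (S u) = card (S v)"
  shows "fixing_nbhd G u v = {w \<in> moved_vertices G. card (S w \<inter> S u) \<noteq> card (S w \<inter> S v)}"
proof -
  obtain g where "g \<in> automorphisms G" "g u = v"
    \<comment> \<open>The empty \<open>W\<close> gives an automorphism from \<open>u\<close> to
      \<open>v\<close>, which rules out the conventional empty case of
      \<open>fixing_nbhd\<close>.\<close>
    using automorphism_of_cards[OF uv card, of "{}"] by auto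
  then have orbit: "vertex_orbit G u = vertex_orbit G v"
    using vertex_orbit_image by metis
  have "stabilizer_orbit G w u = stabilizer_orbit G w v \<longleftrightarrow> card (S w \<inter> S u) = card (S w \<inter> S v)"
    if w: "w \<in> verts G" for w
  proof
    assume "stabilizer_orbit G w u = stabilizer_orbit G w v"
    moreover have "v \<in> stabilizer_orbit G w v"
      by (auto simp: stabilizer_orbit_def id_in_vertex_stabilizer intro!: exI[of _ id])
    ultimately have "v \<in> stabilizer_orbit G w u"
      by simp
    then obtain g where g: "g \<in> automorphisms G" "g w = w" "g u = v"
      by (auto simp: stabilizer_orbit_def vertex_stabilizer_def)
    have "card (S w \<union> S v) = card (S w \<union> S u)"
      using card_S_Un_automorphism[OF g(1) w uv(1)] g by simp
    moreover have "finite (S w)" "finite (S u)" "finite (S v)"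
      using w uv S_subset finite_ground finite_subset by blast+
    ultimately show "card (S w \<inter> S u) = card (S w \<inter> S v)"
      using card card_Un_Int[of "S w" "S u"] card_Un_Int[of "S w" "S v"] by simp
  next
    assume "card (S w \<inter> S u) = card (S w \<inter> S v)"
    then obtain g where "g \<in> automorphisms G" "g u = v" "g w = w"
      using automorphism_of_cards[OF uv card S_subset[OF w]] w by metis
    then show "stabilizer_orbit G w u = stabilizer_orbit G w v"
      using stabilizer_orbit_image[of g G w u] by (simp add: vertex_stabilizer_def)
  qed
  then show ?thesis
    using orbit by (auto simp: fixing_nbhd_def moved_vertices_def)
qed

end

section \<open>Vectors over the field of two elements and their skeletons\<close>

lemma two_element_field:
  fixes c :: "'k::field"
  assumes "card (UNIV :: 'k set) = 2" "c \<noteq> 0"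
  shows "c = 1"
proof -
  have "finite (UNIV :: 'k set)"
    using assms(1) by (metis card.infinite zero_neq_numeral)
  then have "{0, 1} = (UNIV :: 'k set)"
    using assms(1) by (intro card_subset_eq) auto
  then show ?thesis
    using assms(2) by blast
qed

text \<open>The inverse sends a set of basis vectors to its sum: every nonzero coefficient is
  \<open>1\<close>, so a vector is the sum of its skeleton.\<close>

lemma bij_betw_skeleton:
  fixes scale :: "'k::field \<Rightarrow> 'v::ab_group_add \<Rightarrow> 'v"
  assumes two: "card (UNIV :: 'k set) = 2" and "finite_dimensional_vector_space scale B"
  shows "bij_betw (skeleton scale B) (UNIV - {0}) (Pow B - {{}})"
proof -
  interpret finite_dimensional_vector_space scale B by fact
  have sum_skeleton: "\<Sum>(skeleton scale B v) = v" for v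
  proof -
    have "skeleton scale B v = {b. representation B v b \<noteq> 0}"
      using representation_ne_zero by (auto simp: skeleton_def)
    moreover have "(\<Sum>b | representation B v b \<noteq> 0. scale (representation B v b) b)
        = \<Sum>{b. representation B v b \<noteq> 0}"
      using two_element_field[OF two] by (intro sum.cong) (auto, metis scale_one)
    ultimately show ?thesis
      using sum_nonzero_representation_eq[of B v] independent_Basis span_Basis by simp
  qed
  have skeleton_sum: "skeleton scale B (\<Sum>A) = A" if "A \<subseteq> B" for A
  proof -
    have "representation B (\<Sum>A) b = (if b \<in> A then 1 else 0)" for b
    proof -
      have "representation B (\<Sum>A) = (\<lambda>b. \<Sum>a\<in>A. representation B a b)"
        using representation_sum[OF independent_Basis, of A "\<lambda>a. a"] span_Basis by simp
      also have "\<dots> = (\<lambda>b. \<Sum>a\<in>A. if a = b then 1 else 0)"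
        using that representation_basis[OF independent_Basis]
        by (intro ext sum.cong) auto
      finally show ?thesis
        using that finite_Basis by (simp add: finite_subset)
    qed
    then show ?thesis
      using that by (auto simp: skeleton_def)
  qed
  show ?thesis
  proof (rule bij_betw_byWitness[where f' = "\<lambda>A. \<Sum>A"])
    show "skeleton scale B ` (UNIV - {0}) \<subseteq> Pow B - {{}}"
    proof -
      have "skeleton scale B x \<noteq> {}" if "x \<noteq> 0" for x
        using that sum_skeleton[of x] by auto
      then show ?thesis
        by (auto simp: skeleton_def)
    qed
    show "(\<lambda>A. \<Sum>A) ` (Pow B - {{}}) \<subseteq> UNIV - {0}"
    proof -
      \<comment> \<open>If the sum were \<open>0\<close>, which is also the sum over
        \<open>{}\<close>, comparing skeletons would give \<open>A = {}\<close>.\<close>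
      have "\<Sum>A \<noteq> 0" if "A \<subseteq> B" "A \<noteq> {}" for A
        using skeleton_sum[OF that(1)] skeleton_sum[of "{}"] that(2) by auto
      then show ?thesis by auto
    qed
  qed (auto simp: sum_skeleton skeleton_sum)
qed

theorem theorem3p2:
  fixes scale :: "'k::field \<Rightarrow> 'v::ab_group_add \<Rightarrow> 'v"
    and B :: "'v set" and n i :: nat and u v :: 'v
  assumes "card (UNIV :: 'k set) = 2"
    and "finite_dimensional_vector_space scale B"
    and "vector_space.dim scale (UNIV :: 'v set) = n"
    and "n \<ge> 3"
    and "1 \<le> i" and "i \<le> n - 1"
    and "u \<in> skeleton_class scale B i"
    and "v \<in> skeleton_class scale B i"
  shows "fixing_nbhd (nonzero_component_graph scale B) u v =
    {w \<in> moved_vertices (nonzero_component_graph scale B).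
      card (skeleton scale B w \<inter> skeleton scale B u) \<noteq> card (skeleton scale B w \<inter> skeleton scale B v)}"
proof -
  interpret subset_intersection_graph "nonzero_component_graph scale B" B "skeleton scale B"
  proof
    show "finite B"
      using assms(2) by (rule finite_dimensional_vector_space.finite_Basis)
    show "bij_betw (skeleton scale B) (verts (nonzero_component_graph scale B)) (Pow B - {{}})"
      using bij_betw_skeleton[OF assms(1,2)] by (simp add: nonzero_component_graph_def)
  qed (auto simp: nonzero_component_graph_def skeleton_def)
  show ?thesis
    using assms(7,8) by (intro fixing_nbhd_eq) (auto simp: skeleton_class_def)
qed

end
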